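(* Let $\mathcal{I}$ be an ideal on $\mathbf{N}$. Then the following are equivalent: (1) $\mathcal{I}$ is meager; (2) there exists a strictly increasing sequence $(\iota_n)_{n\in\mathbf{N}}$ of positive integers such that, for every $A\subseteq\mathbf{N}$, $A\notin\mathcal{I}$ whenever $\mathbf{N}\cap[\iota_n,\iota_{n+1})\subseteq A$ for infinitely many $n\in\mathbf{N}$; (3) $\mathcal{I}$ is $F_\sigma$-separated from the Fréchet filter $\mathrm{Fin}^\star$, that is, there exists an $F_\sigma$-set $\mathcal{B}\subseteq\mathcal{P}(\mathbf{N})$ such that $\mathcal{I}\subseteq\mathcal{B}$ and $\mathcal{B}\cap\mathrm{Fin}^\star=\emptyset$.
   Context: $\mathbf{N}$ denotes the positive integers. An ideal on $\mathbf{N}$ is a family $\mathcal{I}\subseteq\mathcal{P}(\mathbf{N})$ closed under subsets and finite unions; it is always assumed that $\mathcal{I}$ contains the ideal $\mathrm{Fin}$ of all finite subsets of $\mathbf{N}$ and that $\mathcal{I}\neq\mathcal{P}(\mathbf{N})$. $\mathcal{P}(\mathbf{N})$ is identified with the Cantor space $\{0,1\}^{\mathbf{N}}$ via characteristic functions, and the topological notions (meager, $F_\sigma$) refer to this space. $\mathrm{Fin}^\star:=\{A\subseteq\mathbf{N}:\mathbf{N}\setminus A\text{ is finite}\}$ is the family of cofinite sets. *)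

theory Defs
  imports "HOL-Analysis.Analysis"
begin

abbreviation pos_nat :: "nat set" where
  "pos_nat \<equiv> {1..}"

definition set_ideal :: "nat set set \<Rightarrow> bool" where
  "set_ideal \<I> \<longleftrightarrow>
     \<I> \<subseteq> Pow pos_nat \<and>
     (\<forall>A B. A \<in> \<I> \<and> B \<subseteq> A \<longrightarrow> B \<in> \<I>) \<and>
     (\<forall>A B. A \<in> \<I> \<and> B \<in> \<I> \<longrightarrow> A \<union> B \<in> \<I>) \<and>
     {A. A \<subseteq> pos_nat \<and> finite A} \<subseteq> \<I> \<and>
     \<I> \<noteq> Pow pos_nat"

definition cofinite_sets :: "nat set set" where
  "cofinite_sets = {A. A \<subseteq> pos_nat \<and> finite (pos_nat - A)}"

text \<open>The topology on the powerset is transported from the product of discrete two-point spaces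
  along the map sending a set to its characteristic function.\<close>

definition powerset_topology :: "nat set topology" where
  "powerset_topology =
     pullback_topology (Pow pos_nat) (\<lambda>A. restrict (indicator A) pos_nat)
       (product_topology (\<lambda>_. discrete_topology {0, 1 :: nat}) pos_nat)"

lemma topspace_powerset_topology: "topspace powerset_topology = Pow pos_nat"
  by (auto simp: powerset_topology_def topspace_pullback_topology indicator_def)

definition nowhere_dense_in :: "'a topology \<Rightarrow> 'a set \<Rightarrow> bool" where
  "nowhere_dense_in X S \<longleftrightarrow>
     S \<subseteq> topspace X \<and> X interior_of (X closure_of S) = {}"

definition meager_in :: "'a topology \<Rightarrow> 'a set \<Rightarrow> bool" where
  "meager_in X S \<longleftrightarrow> (\<exists>\<F>. countable \<F> \<and> (\<forall>T\<in>\<F>. nowhere_dense_in X T) \<and> S = \<Union>\<F>)"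

definition fsigma_separated :: "nat set set \<Rightarrow> nat set set \<Rightarrow> bool" where
  "fsigma_separated \<A> \<C> \<longleftrightarrow>
     (\<exists>\<B>. fsigma_in powerset_topology \<B> \<and> \<A> \<subseteq> \<B> \<and> \<B> \<inter> \<C> = {})"

end

theory Submission
  imports Defs
begin

text \<open>Meagerness yields the intervals by Talagrand's block argument: choose consecutive blocks of
  bits so that any set whose trace on the \<open>n\<close>-th interval is the \<open>n\<close>-th block lies outside the
  first \<open>n\<close> nowhere dense sets. A member of the ideal containing infinitely many intervals would
  contain a union of infinitely many blocks, which lies in the ideal but in none of the nowhere
  dense sets. Given the intervals, the sets containing only finitely many of them form an
  \<open>F\<^sub>\<sigma>\<close>-set separating the ideal from the cofinite sets. Finally, as the cofinite sets are dense,
  each closed piece of a separating \<open>F\<^sub>\<sigma>\<close>-set has empty interior.\<close>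

section \<open>Cylinders and open sets of the Cantor space\<close>

lemma restrict_indicator_vimage_PiE:
  assumes "A \<subseteq> pos_nat"
  shows "{B. B \<subseteq> pos_nat \<and> B \<inter> {..<m} = A \<inter> {..<m}} =
    (\<lambda>A. restrict (indicator A) pos_nat) -`
      (\<Pi>\<^sub>E i\<in>pos_nat. if i < m then {indicator A i} else {0, 1 :: nat}) \<inter> Pow pos_nat"
proof -
  have mem: "restrict (indicator B) pos_nat \<in>
      (\<Pi>\<^sub>E i\<in>pos_nat. if i < m then {indicator A i} else {0, 1 :: nat})
    \<longleftrightarrow> (\<forall>i\<in>pos_nat. i < m \<longrightarrow> (i \<in> B \<longleftrightarrow> i \<in> A))" for B
    by (simp add: PiE_iff indicator_def) blast
  have agree: "B \<inter> {..<m} = A \<inter> {..<m} \<longleftrightarrow> (\<forall>i\<in>pos_nat. i < m \<longrightarrow> (i \<in> B \<longleftrightarrow> i \<in> A))"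
    if "B \<subseteq> pos_nat" for B
    using that assms by blast
  show ?thesis
    by (rule set_eqI, unfold mem_Collect_eq Int_iff vimage_eq Pow_iff mem) (metis agree)
qed

text \<open>A cylinder is the preimage of a box that constrains only the finitely many coordinates
  below \<open>m\<close>, and such a box is open in the product.\<close>

lemma openin_cylinder:
  assumes "A \<subseteq> pos_nat"
  shows "openin powerset_topology {B. B \<subseteq> pos_nat \<and> B \<inter> {..<m} = A \<inter> {..<m}}"
proof -
  let ?X = "\<lambda>i. if i < m then {indicator A i} else {0, 1 :: nat}"
  have "{i \<in> pos_nat. ?X i \<noteq> topspace (discrete_topology {0, 1 :: nat})} \<subseteq> {..<m}"
    by auto
  then have "finite {i \<in> pos_nat. ?X i \<noteq> topspace (discrete_topology {0, 1 :: nat})}"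
    by (rule finite_subset) simp
  then have "openin (product_topology (\<lambda>_. discrete_topology {0, 1 :: nat}) pos_nat)
      (\<Pi>\<^sub>E i\<in>pos_nat. ?X i)"
    by (auto simp: openin_PiE_gen indicator_def)
  then show ?thesis
    unfolding powerset_topology_def openin_pullback_topology
      restrict_indicator_vimage_PiE[OF assms] by blast
qed

text \<open>Cylinders form a base: a basic box around \<open>A\<close> constrains finitely many
  coordinates, all below some \<open>m\<close>, so it contains the cylinder given by the bits of
  \<open>A\<close> below \<open>m\<close>. Openness thus becomes a statement about finite
  prefixes.\<close>

lemma openin_powerset_topology_iff:
  "openin powerset_topology U \<longleftrightarrow> U \<subseteq> Pow pos_nat \<and>
    (\<forall>A\<in>U. \<exists>m. \<forall>B\<subseteq>pos_nat. B \<inter> {..<m} = A \<inter> {..<m} \<longrightarrow> B \<in> U)"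
  (is "_ \<longleftrightarrow> _ \<and> ?R U")
proof (intro iffI conjI)
  assume U: "openin powerset_topology U"
  then show "U \<subseteq> Pow pos_nat"
    using openin_subset topspace_powerset_topology by blast
  obtain V where V: "openin (product_topology (\<lambda>_. discrete_topology {0, 1 :: nat}) pos_nat) V"
    and UV: "U = (\<lambda>A. restrict (indicator A) pos_nat) -` V \<inter> Pow pos_nat"
    using U unfolding powerset_topology_def openin_pullback_topology by blast
  show "?R U"
  proof
    fix A assume A: "A \<in> U"
    then have "restrict (indicator A) pos_nat \<in> V"
      using UV by auto
    then obtain X where fin: "finite {i \<in> pos_nat. X i \<noteq> topspace (discrete_topology {0, 1 :: nat})}"
      and AX: "restrict (indicator A) pos_nat \<in> Pi\<^sub>E pos_nat X" and XV: "Pi\<^sub>E pos_nat X \<subseteq> V"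
      using V unfolding openin_product_topology_alt by meson
    obtain m where m: "{i \<in> pos_nat. X i \<noteq> {0, 1 :: nat}} \<subseteq> {..<m}"
      using fin unfolding topspace_discrete_topology by (meson finite_nat_iff_bounded)
    have "B \<in> U" if B: "B \<subseteq> pos_nat" "B \<inter> {..<m} = A \<inter> {..<m}" for B
    proof -
      have "indicator B i \<in> X i" if i: "i \<in> pos_nat" for i
      proof (cases "i < m")
        case True
        then have "(indicator B i :: nat) = indicator A i"
          using B(2) by (auto simp: indicator_def)
        moreover have "indicator A i \<in> X i"
          using AX i by (auto simp: PiE_iff)
        ultimately show ?thesis by simp
      next
        case False
        then have "X i = {0, 1}" using m i by blast
        then show ?thesis by (simp add: indicator_def)
      qed
      then have "restrict (indicator B) pos_nat \<in> Pi\<^sub>E pos_nat X"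
        by auto
      then show ?thesis using XV UV B(1) by blast
    qed
    then show "\<exists>m. \<forall>B\<subseteq>pos_nat. B \<inter> {..<m} = A \<inter> {..<m} \<longrightarrow> B \<in> U"
      by blast
  qed
next
  assume R: "U \<subseteq> Pow pos_nat \<and> ?R U"
  show "openin powerset_topology U"
  proof (subst openin_subopen, intro ballI)
    fix A assume A: "A \<in> U"
    then obtain m where m: "\<forall>B\<subseteq>pos_nat. B \<inter> {..<m} = A \<inter> {..<m} \<longrightarrow> B \<in> U"
      using R by blast
    have "A \<subseteq> pos_nat" using A R by blast
    then show "\<exists>T. openin powerset_topology T \<and> A \<in> T \<and> T \<subseteq> U"
      using openin_cylinder m
      by (intro exI[of _ "{B. B \<subseteq> pos_nat \<and> B \<inter> {..<m} = A \<inter> {..<m}}"]) blast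
  qed
qed

section \<open>Finite extensions that escape nowhere dense sets\<close>

text \<open>The closure of \<open>N\<close> has empty interior, so the cylinder of \<open>A\<close>
  contains a point \<open>C\<close> outside it. The complement of the closure is open, hence a long
  enough prefix of \<open>C\<close> already keeps every set out of \<open>N\<close>.\<close>

lemma nowhere_dense_in_avoid_cylinder:
  assumes N: "nowhere_dense_in powerset_topology N" and A: "A \<subseteq> pos_nat"
  obtains m' C where "m \<le> m'" "C \<subseteq> pos_nat" "C \<inter> {..<m} = A \<inter> {..<m}"
    "\<And>B. B \<subseteq> pos_nat \<Longrightarrow> B \<inter> {..<m'} = C \<inter> {..<m'} \<Longrightarrow> B \<notin> N"
proof -
  let ?K = "powerset_topology closure_of N"
  let ?Z = "{B. B \<subseteq> pos_nat \<and> B \<inter> {..<m} = A \<inter> {..<m}}"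
  have "\<not> ?Z \<subseteq> ?K"
  proof
    assume "?Z \<subseteq> ?K"
    then have "?Z \<subseteq> powerset_topology interior_of ?K"
      using openin_cylinder[OF A] by (rule interior_of_maximal)
    then have "?Z \<subseteq> {}"
      using N unfolding nowhere_dense_in_def by simp
    moreover have "A \<in> ?Z" using A by simp
    ultimately show False by blast
  qed
  then obtain C where C: "C \<subseteq> pos_nat" "C \<inter> {..<m} = A \<inter> {..<m}" "C \<notin> ?K"
    by blast
  have "openin powerset_topology (topspace powerset_topology - ?K)"
    by (intro openin_diff openin_topspace closedin_closure_of)
  moreover have "C \<in> topspace powerset_topology - ?K"
    using C unfolding topspace_powerset_topology by simp
  ultimately obtain k where
    k: "\<forall>B\<subseteq>pos_nat. B \<inter> {..<k} = C \<inter> {..<k} \<longrightarrow> B \<in> topspace powerset_topology - ?K"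
    unfolding openin_powerset_topology_iff by blast
  have NK: "N \<subseteq> ?K"
    using N unfolding nowhere_dense_in_def by (simp add: closure_of_subset)
  show thesis
  proof
    \<comment> \<open>\<open>k\<close> may be smaller than \<open>m\<close>; the maximum makes the
      new prefix at least as long as the old one.\<close>
    show "m \<le> max m k" by simp
    show "C \<subseteq> pos_nat" "C \<inter> {..<m} = A \<inter> {..<m}" by (fact C)+
    fix B assume B: "B \<subseteq> pos_nat" "B \<inter> {..<max m k} = C \<inter> {..<max m k}"
    then have "B \<inter> {..<k} = C \<inter> {..<k}"
      by (auto simp: set_eq_iff less_max_iff_disj)
    then show "B \<notin> N" using k B(1) NK by blast
  qed
qed

text \<open>One block of bits can be chosen to leave finitely many nowhere dense sets simultaneously,
  whatever the preceding bits are, by treating the pairs of a prefix and a set one after another.\<close>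

lemma nowhere_dense_avoid_block:
  assumes "finite P" and "P \<subseteq> Pow {1..<m} \<times> Collect (nowhere_dense_in powerset_topology)"
  shows "\<exists>m'\<ge>m. \<exists>S\<subseteq>pos_nat \<inter> {m..<m'}. \<forall>(T, N)\<in>P. \<forall>B\<subseteq>pos_nat.
    B \<inter> {..<m} = T \<longrightarrow> B \<inter> {m..<m'} = S \<longrightarrow> B \<notin> N"
  using assms
proof (induction P)
  case empty
  then show ?case by blast
next
  case (insert p P)
  obtain T N where p: "p = (T, N)" by fastforce
  have T: "T \<subseteq> {1..<m}" and N: "nowhere_dense_in powerset_topology N"
    using insert.prems p by auto
  have "P \<subseteq> Pow {1..<m} \<times> Collect (nowhere_dense_in powerset_topology)"
    using insert.prems by simp
  from insert.IH[OF this]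
  obtain m' S where m': "m \<le> m'" and S: "S \<subseteq> pos_nat \<inter> {m..<m'}"
    and av: "\<forall>(T, N)\<in>P. \<forall>B\<subseteq>pos_nat. B \<inter> {..<m} = T \<longrightarrow> B \<inter> {m..<m'} = S \<longrightarrow> B \<notin> N"
    by (elim exE conjE) (rule that)
  \<comment> \<open>The block \<open>S\<close> built for \<open>P\<close> is kept and only extended:
    starting from the prefix \<open>T\<close> followed by \<open>S\<close>, the bits of
    \<open>C\<close> from \<open>m'\<close> on are chosen to leave \<open>N\<close>.\<close>
  have "T \<union> S \<subseteq> pos_nat" using T S by auto
  with N obtain m'' C where m'': "m' \<le> m''" and C: "C \<subseteq> pos_nat"
    and CT: "C \<inter> {..<m'} = (T \<union> S) \<inter> {..<m'}"
    and CN: "\<And>B. B \<subseteq> pos_nat \<Longrightarrow> B \<inter> {..<m''} = C \<inter> {..<m''} \<Longrightarrow> B \<notin> N"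
    by (rule nowhere_dense_in_avoid_cylinder[where m = m']) (rule that)
  have CS: "C \<inter> {m..<m'} = S"
  proof -
    have "C \<inter> {m..<m'} = (C \<inter> {..<m'}) \<inter> {m..<m'}" by auto
    also have "\<dots> = S" unfolding CT using S T by auto
    finally show ?thesis .
  qed
  have CT': "C \<inter> {..<m} = T"
  proof -
    have "C \<inter> {..<m} = (C \<inter> {..<m'}) \<inter> {..<m}" using m' by auto
    also have "\<dots> = T" unfolding CT using S T m' by auto
    finally show ?thesis .
  qed
  \<comment> \<open>For the new pair, \<open>B\<close> agrees with \<open>C\<close> on all of
    \<open>{..<m''}\<close>. For an old pair, the longer block still begins with \<open>S\<close>,
    and the induction hypothesis applies.\<close>
  have key: "B \<notin> N'"
    if q: "(T', N') \<in> insert p P" and B: "B \<subseteq> pos_nat" "B \<inter> {..<m} = T'"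
      "B \<inter> {m..<m''} = C \<inter> {m..<m''}" for T' N' B
  proof (cases "(T', N') = p")
    case True
    have "B \<inter> {..<m''} = (B \<inter> {..<m}) \<union> (B \<inter> {m..<m''})"
      using m' m'' by auto
    also have "\<dots> = (C \<inter> {..<m}) \<union> (C \<inter> {m..<m''})"
      using B True p CT' by simp
    also have "\<dots> = C \<inter> {..<m''}" using m' m'' by auto
    finally show ?thesis using CN B(1) True p by simp
  next
    case False
    have "B \<inter> {m..<m'} = (B \<inter> {m..<m''}) \<inter> {m..<m'}" using m'' by auto
    also have "\<dots> = C \<inter> {m..<m'}" unfolding B(3) using m'' by auto
    finally show ?thesis using av False q B(1,2) CS by fastforce
  qed
  show ?case
  proof (intro exI conjI)
    show "m \<le> m''" using m' m'' by simp
    show "C \<inter> {m..<m''} \<subseteq> pos_nat \<inter> {m..<m''}" using C by blast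
    show "\<forall>(T, N)\<in>insert p P. \<forall>B\<subseteq>pos_nat.
        B \<inter> {..<m} = T \<longrightarrow> B \<inter> {m..<m''} = C \<inter> {m..<m''} \<longrightarrow> B \<notin> N"
      using key by (intro ballI case_prodI2 allI impI) simp
  qed
qed

section \<open>From meagerness to the intervals\<close>

lemma meager_in_imp_interval_sequence:
  assumes ideal: "set_ideal \<I>" and meager: "meager_in powerset_topology \<I>"
  obtains \<iota> :: "nat \<Rightarrow> nat" where "strict_mono \<iota>" "range \<iota> \<subseteq> pos_nat"
    "\<And>A. A \<subseteq> pos_nat \<Longrightarrow> infinite {n. {\<iota> n..<\<iota> (n + 1)} \<subseteq> A} \<Longrightarrow> A \<notin> \<I>"
proof -
  obtain \<F> where \<F>: "countable \<F>" "\<forall>T\<in>\<F>. nowhere_dense_in powerset_topology T" "\<I> = \<Union>\<F>"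
    using meager unfolding meager_in_def by blast
  \<comment> \<open>The enumeration \<open>F\<close> by \<open>from_nat_into\<close> covers exactly
    \<open>\<F>\<close> only if \<open>\<F>\<close> is nonempty, which follows because its union has
    a member.\<close>
  have "{} \<in> \<I>" using ideal unfolding set_ideal_def by auto
  then have "\<F> \<noteq> {}" using \<F>(3) by auto
  define F where "F = from_nat_into \<F>"
  have rF: "range F = \<F>"
    unfolding F_def using \<F>(1) \<open>\<F> \<noteq> {}\<close> by simp
  have "\<forall>n m. \<exists>m' S. m < m' \<and> S \<subseteq> {m..<m'} \<and>
      (\<forall>k\<le>n. \<forall>B\<subseteq>pos_nat. B \<inter> {m..<m'} = S \<longrightarrow> B \<notin> F k)"
  proof (intro allI)
    fix n m :: nat
    \<comment> \<open>All possible prefixes below \<open>m\<close> are paired with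
      \<open>F 0\<close>, ..., \<open>F n\<close>; this is a finite set, so a single block handles
      every prefix.\<close>
    let ?P = "Pow {1..<m} \<times> F ` {..n}"
    have "\<exists>m'\<ge>m. \<exists>S\<subseteq>pos_nat \<inter> {m..<m'}. \<forall>(T, N)\<in>?P. \<forall>B\<subseteq>pos_nat.
        B \<inter> {..<m} = T \<longrightarrow> B \<inter> {m..<m'} = S \<longrightarrow> B \<notin> N"
      by (rule nowhere_dense_avoid_block) (use \<F>(2) rF in auto)
    then obtain m' S where m': "m \<le> m'" "S \<subseteq> {m..<m'}"
      and S: "\<forall>(T, N)\<in>?P. \<forall>B\<subseteq>pos_nat. B \<inter> {..<m} = T \<longrightarrow> B \<inter> {m..<m'} = S \<longrightarrow> B \<notin> N"
      by auto
    \<comment> \<open>The block may be empty, as only \<open>m \<le> m'\<close> is known. One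
      further position \<open>m'\<close>, with bit zero, gives the strict inequality that makes
      \<open>\<iota>\<close> strictly increasing.\<close>
    have "B \<notin> F k" if "k \<le> n" "B \<subseteq> pos_nat" "B \<inter> {m..<Suc m'} = S" for k B
    proof -
      have "B \<inter> {..<m} \<in> Pow {1..<m}" using that(2) by auto
      moreover have "B \<inter> {m..<m'} = S" using that(3) m' by auto
      ultimately show ?thesis using S that(1,2) by blast
    qed
    moreover have "S \<subseteq> {m..<Suc m'}" using m'(2) by auto
    moreover have "m < Suc m'" using m'(1) by simp
    ultimately show "\<exists>m' S. m < m' \<and> S \<subseteq> {m..<m'} \<and>
        (\<forall>k\<le>n. \<forall>B\<subseteq>pos_nat. B \<inter> {m..<m'} = S \<longrightarrow> B \<notin> F k)"
      by (intro exI[of _ "Suc m'"] exI[of _ S] conjI allI impI)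
  qed
  then obtain e S where eS: "\<forall>n m. m < e n m \<and> S n m \<subseteq> {m..<e n m} \<and>
      (\<forall>k\<le>n. \<forall>B\<subseteq>pos_nat. B \<inter> {m..<e n m} = S n m \<longrightarrow> B \<notin> F k)"
    unfolding choice_iff by (elim exE) (rule that)
  then have e: "m < e n m" and Se: "S n m \<subseteq> {m..<e n m}" for n m
    by auto
  have av: "B \<notin> F k" if "k \<le> n" "B \<subseteq> pos_nat" "B \<inter> {m..<e n m} = S n m" for n m k B
    using eS that by blast
  \<comment> \<open>Each interval starts where the previous block ends; the start value 1 keeps all
    endpoints positive.\<close>
  define \<iota> where "\<iota> = rec_nat 1 e"
  have \<iota>0: "\<iota> 0 = 1" and \<iota>Suc: "\<iota> (Suc n) = e n (\<iota> n)" for n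
    by (simp_all add: \<iota>_def)
  have mono: "strict_mono \<iota>"
    using e \<iota>Suc by (simp add: strict_mono_Suc_iff)
  have pos: "range \<iota> \<subseteq> pos_nat"
    using strict_mono_mono[OF mono] \<iota>0 by (metis atLeast_iff image_subsetI le0 monoD)
  have "A \<notin> \<I>" if A: "A \<subseteq> pos_nat" and inf: "infinite {n. {\<iota> n..<\<iota> (n + 1)} \<subseteq> A}" for A
  proof
    assume "A \<in> \<I>"
    let ?J = "{n. {\<iota> n..<\<iota> (n + 1)} \<subseteq> A}"
    \<comment> \<open>Only blocks of intervals inside \<open>A\<close> are collected, so
      \<open>B\<close> is a subset of \<open>A\<close> and lies in the ideal. As the intervals are
      disjoint, \<open>B\<close> has exactly the prescribed trace on each of them.\<close>
    define B where "B = (\<Union>n\<in>?J. S n (\<iota> n))"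
    have Sn: "S n (\<iota> n) \<subseteq> {\<iota> n..<\<iota> (n + 1)}" for n
      using Se \<iota>Suc by simp
    have "B \<subseteq> A" unfolding B_def using Sn by blast
    then have "B \<in> \<I>" using ideal \<open>A \<in> \<I>\<close> unfolding set_ideal_def by blast
    then obtain k where k: "B \<in> F k" using \<F>(3) rF by auto
    \<comment> \<open>The \<open>n\<close>-th block avoids \<open>F k\<close> only for
      \<open>k \<le> n\<close>; infinitely many intervals inside \<open>A\<close> provide such an
      \<open>n\<close>.\<close>
    obtain n where n: "k \<le> n" "n \<in> ?J"
      using inf by (meson infinite_nat_iff_unbounded_le)
    have disj: "i = n" if "x \<in> {\<iota> i..<\<iota> (i + 1)}" "x \<in> {\<iota> n..<\<iota> (n + 1)}" for i x
    proof (rule ccontr)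
      assume "i \<noteq> n"
      then consider "i + 1 \<le> n" | "n + 1 \<le> i" by linarith
      then show False
        using that strict_mono_mono[OF mono] by cases (fastforce dest: monoD)+
    qed
    have "B \<inter> {\<iota> n..<\<iota> (n + 1)} = S n (\<iota> n)"
      unfolding B_def using Sn disj n(2) by blast
    then have "B \<notin> F k"
      using av[of k n B "\<iota> n"] n(1) A \<open>B \<subseteq> A\<close> \<iota>Suc by simp
    then show False using k by simp
  qed
  with mono pos show thesis by (rule that)
qed

section \<open>From the intervals to a separating F-sigma set\<close>

text \<open>Whether a set contains the \<open>n\<close>-th interval is decided by its bits below
  \<open>\<iota> (n + 1)\<close>, so the complement is open.\<close>

lemma closedin_eventually_no_interval:
  "closedin powerset_topology
     {A. A \<subseteq> pos_nat \<and> (\<forall>n\<ge>k. \<not> pos_nat \<inter> {\<iota> n..<\<iota> (n + 1) :: nat} \<subseteq> A)}"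
proof -
  have "openin powerset_topology
      {A. A \<subseteq> pos_nat \<and> (\<exists>n\<ge>k. pos_nat \<inter> {\<iota> n..<\<iota> (n + 1) :: nat} \<subseteq> A)}" (is "openin _ ?U")
    unfolding openin_powerset_topology_iff
  proof (intro conjI ballI)
    fix A assume "A \<in> ?U"
    then obtain n where n: "n \<ge> k" "pos_nat \<inter> {\<iota> n..<\<iota> (n + 1)} \<subseteq> A" by blast
    have "pos_nat \<inter> {\<iota> n..<\<iota> (n + 1)} \<subseteq> B" if "B \<inter> {..<\<iota> (n + 1)} = A \<inter> {..<\<iota> (n + 1)}" for B
      using n(2) that by (auto simp: set_eq_iff subset_iff)
    then show "\<exists>m. \<forall>B\<subseteq>pos_nat. B \<inter> {..<m} = A \<inter> {..<m} \<longrightarrow> B \<in> ?U"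
      using n(1) by (intro exI[of _ "\<iota> (n + 1)"]) blast
  qed auto
  moreover have "Pow pos_nat - {A. A \<subseteq> pos_nat \<and> (\<forall>n\<ge>k. \<not> pos_nat \<inter> {\<iota> n..<\<iota> (n + 1)} \<subseteq> A)} = ?U"
    by auto
  ultimately show ?thesis
    unfolding closedin_def topspace_powerset_topology by auto
qed

lemma interval_sequence_imp_fsigma_separated:
  fixes \<iota> :: "nat \<Rightarrow> nat"
  assumes ideal: "set_ideal \<I>" and mono: "strict_mono_on pos_nat \<iota>"
    and pos: "\<iota> ` pos_nat \<subseteq> pos_nat"
    and av: "\<And>A. A \<subseteq> pos_nat \<Longrightarrow>
      infinite {n \<in> pos_nat. pos_nat \<inter> {\<iota> n..<\<iota> (n + 1)} \<subseteq> A} \<Longrightarrow> A \<notin> \<I>"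
  shows "fsigma_separated \<I> cofinite_sets"
proof -
  define C where
    "C k = {A. A \<subseteq> pos_nat \<and> (\<forall>n\<ge>k. \<not> pos_nat \<inter> {\<iota> n..<\<iota> (n + 1)} \<subseteq> A)}" for k
  have "closedin powerset_topology (C k)" for k
    unfolding C_def by (rule closedin_eventually_no_interval)
  then have "fsigma_in powerset_topology (\<Union>k. C k)"
    by (intro fsigma_in_Union) (auto intro: closed_imp_fsigma_in)
  moreover have "\<I> \<subseteq> (\<Union>k. C k)"
  proof
    fix A assume A: "A \<in> \<I>"
    have "\<I> \<subseteq> Pow pos_nat" using ideal by (simp add: set_ideal_def)
    with A have sub: "A \<subseteq> pos_nat" by blast
    have "finite {n \<in> pos_nat. pos_nat \<inter> {\<iota> n..<\<iota> (n + 1)} \<subseteq> A}"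
      by (rule ccontr) (use av[OF sub] A in simp)
    then obtain k where k: "{n \<in> pos_nat. pos_nat \<inter> {\<iota> n..<\<iota> (n + 1)} \<subseteq> A} \<subseteq> {..<k}"
      by (meson finite_nat_iff_bounded)
    \<comment> \<open>\<open>av\<close> counts positive indices only. Starting at
      \<open>Suc k\<close> instead of \<open>k\<close> excludes the index 0 when
      \<open>k = 0\<close>.\<close>
    have "\<not> pos_nat \<inter> {\<iota> n..<\<iota> (n + 1)} \<subseteq> A" if n: "Suc k \<le> n" for n
    proof
      assume "pos_nat \<inter> {\<iota> n..<\<iota> (n + 1)} \<subseteq> A"
      moreover have "n \<in> pos_nat" using n by simp
      ultimately have "n \<in> {..<k}" by (intro subsetD[OF k] CollectI conjI)
      then show False using n by simp
    qed
    then have "A \<in> C (Suc k)"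
      unfolding C_def using sub by simp
    then show "A \<in> (\<Union>k. C k)" by blast
  qed
  moreover have "(\<Union>k. C k) \<inter> cofinite_sets = {}"
  proof -
    \<comment> \<open>This growth drives the intervals past any finite set. It starts at 1 because
      nothing is assumed about \<open>\<iota> 0\<close>.\<close>
    have ge: "n \<le> \<iota> n" if "1 \<le> n" for n
      using that
    proof (induction n)
      case (Suc n)
      show ?case
      proof (cases "n = 0")
        case True
        then show ?thesis using pos by auto
      next
        case False
        then have "\<iota> n < \<iota> (Suc n)"
          using mono by (auto simp: strict_mono_on_def)
        then show ?thesis using Suc False by simp
      qed
    qed simp
    have "A \<notin> C k" if A: "A \<in> cofinite_sets" for A k
    proof -
      obtain j where j: "pos_nat - A \<subseteq> {..<j}"
        using A unfolding cofinite_sets_def by (auto dest: finite_nat_iff_bounded[THEN iffD1])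
      \<comment> \<open>This index is positive, at least \<open>k\<close>, and so large that the
        \<open>n\<close>-th interval lies beyond every point missing from \<open>A\<close>.\<close>
      define n where "n = Suc (max j k)"
      have "j \<le> \<iota> n" using ge[of n] unfolding n_def by simp
      then have "pos_nat \<inter> {\<iota> n..<\<iota> (n + 1)} \<subseteq> A"
        using j by fastforce
      moreover have "k \<le> n" unfolding n_def by simp
      ultimately show ?thesis unfolding C_def by blast
    qed
    then show ?thesis by blast
  qed
  ultimately show ?thesis unfolding fsigma_separated_def by blast
qed

section \<open>From separation to meagerness\<close>

lemma closedin_disjoint_cofinite_nowhere_dense:
  assumes C: "closedin powerset_topology C" "C \<inter> cofinite_sets = {}" and "N \<subseteq> C"
  shows "nowhere_dense_in powerset_topology N"
proof -
  have "A \<notin> powerset_topology interior_of C" for A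
  proof
    assume A: "A \<in> powerset_topology interior_of C"
    then obtain m where
      m: "\<forall>B\<subseteq>pos_nat. B \<inter> {..<m} = A \<inter> {..<m} \<longrightarrow> B \<in> powerset_topology interior_of C"
      using openin_interior_of[of powerset_topology C] unfolding openin_powerset_topology_iff
      by blast
    have Ap: "A \<subseteq> pos_nat"
      using A interior_of_subset_topspace[of powerset_topology C]
      unfolding topspace_powerset_topology by blast
    \<comment> \<open>Filling in all positions from \<open>m\<close> on preserves the prefix, so the
      set stays in the interior of \<open>C\<close>, yet it becomes cofinite.\<close>
    let ?B = "A \<union> (pos_nat \<inter> {m..})"
    have "?B \<in> powerset_topology interior_of C"
    proof (intro m[rule_format])
      show "?B \<subseteq> pos_nat" using Ap by simp
      show "?B \<inter> {..<m} = A \<inter> {..<m}" by auto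
    qed
    then have "?B \<in> C" by (rule subsetD[OF interior_of_subset])
    moreover have "?B \<in> cofinite_sets"
    proof -
      have "pos_nat - ?B \<subseteq> {..<m}" by auto
      then have "finite (pos_nat - ?B)" by (rule finite_subset) simp
      then show ?thesis unfolding cofinite_sets_def using Ap by simp
    qed
    ultimately show False using C(2) by blast
  qed
  moreover have "powerset_topology interior_of (powerset_topology closure_of N)
      \<subseteq> powerset_topology interior_of C"
    using assms by (intro interior_of_mono closure_of_minimal)
  ultimately have "powerset_topology interior_of (powerset_topology closure_of N) = {}"
    by blast
  moreover have "N \<subseteq> topspace powerset_topology"
    using \<open>N \<subseteq> C\<close> closedin_subset[OF C(1)] by (rule order_trans)
  ultimately show ?thesis
    unfolding nowhere_dense_in_def by simp
qed

lemma fsigma_separated_imp_meager_in: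
  assumes "fsigma_separated \<I> cofinite_sets"
  shows "meager_in powerset_topology \<I>"
proof -
  obtain \<B> where \<B>: "fsigma_in powerset_topology \<B>" "\<I> \<subseteq> \<B>" "\<B> \<inter> cofinite_sets = {}"
    using assms unfolding fsigma_separated_def by blast
  obtain \<C> where \<C>: "countable \<C>" "\<forall>C\<in>\<C>. closedin powerset_topology C" "\<B> = \<Union>\<C>"
    using \<B>(1) unfolding fsigma_in_def union_of_def by auto
  \<comment> \<open>\<open>meager_in\<close> asks for the ideal to equal a union of nowhere dense
    sets, so the closed pieces, which may exceed the ideal, are intersected with it.\<close>
  have "nowhere_dense_in powerset_topology (\<I> \<inter> C)" if "C \<in> \<C>" for C
  proof (rule closedin_disjoint_cofinite_nowhere_dense)
    show "closedin powerset_topology C" using \<C>(2) that by simp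
    show "C \<inter> cofinite_sets = {}" using \<B>(3) \<C>(3) that by blast
  qed simp
  then have "\<forall>T\<in>(\<inter>) \<I> ` \<C>. nowhere_dense_in powerset_topology T"
    by simp
  moreover have "\<I> = \<Union>((\<inter>) \<I> ` \<C>)"
    using \<B>(2) \<C>(3) by blast
  moreover have "countable ((\<inter>) \<I> ` \<C>)"
    using \<C>(1) by simp
  ultimately show ?thesis
    unfolding meager_in_def by (intro exI[of _ "(\<inter>) \<I> ` \<C>"] conjI)
qed

theorem proposition3p1:
  fixes \<I> :: "nat set set"
  assumes "set_ideal \<I>"
  shows
    "(meager_in powerset_topology \<I> \<longleftrightarrow>
       (\<exists>\<iota> :: nat \<Rightarrow> nat.
          strict_mono_on pos_nat \<iota> \<and> \<iota> ` pos_nat \<subseteq> pos_nat \<and>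
          (\<forall>A. A \<subseteq> pos_nat \<longrightarrow>
             infinite {n \<in> pos_nat. pos_nat \<inter> {\<iota> n..<\<iota> (n + 1)} \<subseteq> A} \<longrightarrow> A \<notin> \<I>))) \<and>
     (meager_in powerset_topology \<I> \<longleftrightarrow> fsigma_separated \<I> cofinite_sets)"
  (is "(?meager \<longleftrightarrow> (\<exists>\<iota>. ?P \<iota>)) \<and> (_ \<longleftrightarrow> ?sep)")
proof -
  have "\<exists>\<iota>. ?P \<iota>" if meager: "?meager"
  proof -
    obtain \<iota> :: "nat \<Rightarrow> nat" where mono: "strict_mono \<iota>" and pos: "range \<iota> \<subseteq> pos_nat"
      and av: "\<And>A. A \<subseteq> pos_nat \<Longrightarrow> infinite {n. {\<iota> n..<\<iota> (n + 1)} \<subseteq> A} \<Longrightarrow> A \<notin> \<I>"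
      by (rule meager_in_imp_interval_sequence[OF assms meager]) (rule that)
    \<comment> \<open>The sequence obtained is indexed from 0, the required one from 1. Its values
      are positive, so the intervals coincide, and infinitely many positive indices are in
      particular infinitely many indices.\<close>
    have eq: "pos_nat \<inter> {\<iota> n..<\<iota> (n + 1)} = {\<iota> n..<\<iota> (n + 1)}" for n
    proof -
      have "1 \<le> \<iota> n" using range_subsetD[OF pos, of n] by simp
      then show ?thesis by auto
    qed
    have "A \<notin> \<I>"
      if A: "A \<subseteq> pos_nat"
        and inf: "infinite {n \<in> pos_nat. pos_nat \<inter> {\<iota> n..<\<iota> (n + 1)} \<subseteq> A}" for A
    proof (rule av[OF A])
      have "{n \<in> pos_nat. pos_nat \<inter> {\<iota> n..<\<iota> (n + 1)} \<subseteq> A} \<subseteq> {n. {\<iota> n..<\<iota> (n + 1)} \<subseteq> A}"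
        unfolding eq by blast
      then show "infinite {n. {\<iota> n..<\<iota> (n + 1)} \<subseteq> A}"
        using inf by (rule infinite_super)
    qed
    moreover have "strict_mono_on pos_nat \<iota>"
      using mono by (simp add: strict_mono_on_def strict_mono_def)
    moreover have "\<iota> ` pos_nat \<subseteq> pos_nat"
      using pos by blast
    ultimately show ?thesis
      by (intro exI[of _ \<iota>] conjI allI impI)
  qed
  moreover have "?sep" if ex: "\<exists>\<iota>. ?P \<iota>"
  proof -
    obtain \<iota> where "?P \<iota>" using ex by (elim exE)
    then show ?thesis
      by (intro interval_sequence_imp_fsigma_separated[OF assms, of \<iota>]) simp_all
  qed
  moreover have "?meager" if "?sep"
    using that by (rule fsigma_separated_imp_meager_in)
  \<comment> \<open>The three implications form a cycle, which yields both equivalences.\<close>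
  ultimately show ?thesis by argo
qed

end
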